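(* The Krull dimension of the ring $\mathcal{A}$ is infinite.
   Context: $\mathds{N}$ denotes the non-negative integers and $\mathds{N}^+=\mathds{N}\setminus\{0\}$. $\mathcal{A}$ is the ring of arithmetical functions: the set of all functions $f\colon \mathds{N}^+\to\mathds{C}$ with pointwise addition $(f+g)(n)=f(n)+g(n)$ and Dirichlet convolution $(f*g)(n)=\sum_{ij=n}f(i)g(j)$ as multiplication. It is a commutative ring with identity $e$, where $e(1)=1$ and $e(n)=0$ for $n>1$. *)

theory Defs
  imports "HOL-Algebra.Ideal" "HOL-Library.Extended_Real" Complex_Main
begin

text \<open>Functions on the positive integers are represented as extensional functions on
  \<^term>\<open>{1::nat..}\<close>, i.e. they take the value \<^term>\<open>undefined\<close> at \<open>0\<close>.\<close>

definition arith_funs :: "(nat \<Rightarrow> complex) ring" where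
  "arith_funs =
    \<lparr>carrier = {1..} \<rightarrow>\<^sub>E UNIV,
     monoid.mult = (\<lambda>f g. \<lambda>n\<in>{1..}. \<Sum>(i, j) | i * j = n. f i * g j),
     one = (\<lambda>n\<in>{1..}. if n = 1 then 1 else 0),
     zero = (\<lambda>n\<in>{1..}. 0),
     add = (\<lambda>f g. \<lambda>n\<in>{1..}. f n + g n)\<rparr>"

text \<open>The value is taken in the extended reals so that a ring without prime ideals
  has dimension \<open>-\<infinity>\<close>, the supremum of the empty set.\<close>

definition krull_dim :: "('a, 'm) ring_scheme \<Rightarrow> ereal" where
  "krull_dim R = Sup {ereal (real n) | n.
     \<exists>P. (\<forall>i\<le>n. primeideal (P i) R) \<and> (\<forall>i<n. P i \<subset> P (Suc i))}"

end

theory Submission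
  imports Defs "HOL-Computational_Algebra.Primes"
begin

text \<open>Under unique factorisation an arithmetical function is a formal power series in
  countably many variables, one for each prime, the coefficient of a monomial being the value
  of the function at the corresponding integer. Setting the first \<open>k\<close> variables to zero is
  a homomorphism onto another power series domain, and its kernel is the set of functions
  that vanish on all integers coprime to the first \<open>k\<close> primes. These kernels form a strictly
  increasing sequence of prime ideals, so chains of every finite length exist.

  The proof works with the kernels directly. They are instances of the vanishing ideal of a set
  of positive integers in which a product lies exactly when both factors do; such an ideal is
  prime (\<open>primeideal_vanishing_ideal\<close>). The point is that positive integers carry a total order
  for which multiplication is strictly monotone: taking in each factor the least point of the
  set where it does not vanish, the convolution reduces to a single nonzero term at the product
  of these points. Strictness
  of the chain is witnessed by the indicator functions of the primes
  (\<open>vanishing_ideal_sieve_psubset\<close>).\<close>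

section \<open>The ring of arithmetical functions\<close>

lemma finite_factorizations:
  assumes "n \<ge> (1::nat)"
  shows "finite {(i, j). i * j = n}"
proof (rule finite_subset)
  show "{(i, j). i * j = n} \<subseteq> {..n} \<times> {..n}"
    using assms by auto
qed simp

lemma carrier_arith_funs [simp]: "carrier arith_funs = {1..} \<rightarrow>\<^sub>E UNIV"
  by (simp add: arith_funs_def)

lemma add_arith_funs_apply:
  "n \<ge> 1 \<Longrightarrow> (f \<oplus>\<^bsub>arith_funs\<^esub> g) n = f n + g n"
  by (simp add: arith_funs_def)

lemma mult_arith_funs_apply:
  "n \<ge> 1 \<Longrightarrow> (f \<otimes>\<^bsub>arith_funs\<^esub> g) n = (\<Sum>(i, j) | i * j = n. f i * g j)"
  by (simp add: arith_funs_def)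

lemma zero_arith_funs_apply: "n \<ge> 1 \<Longrightarrow> \<zero>\<^bsub>arith_funs\<^esub> n = 0"
  by (simp add: arith_funs_def)

lemma one_arith_funs_apply: "n \<ge> 1 \<Longrightarrow> \<one>\<^bsub>arith_funs\<^esub> n = (if n = 1 then 1 else 0)"
  by (simp add: arith_funs_def)

lemma arith_funs_closed:
  "f \<oplus>\<^bsub>arith_funs\<^esub> g \<in> carrier arith_funs"
  "f \<otimes>\<^bsub>arith_funs\<^esub> g \<in> carrier arith_funs"
  "\<zero>\<^bsub>arith_funs\<^esub> \<in> carrier arith_funs"
  "\<one>\<^bsub>arith_funs\<^esub> \<in> carrier arith_funs"
  by (simp_all add: arith_funs_def)

lemma arith_funs_eqI:
  assumes "f \<in> carrier arith_funs" "g \<in> carrier arith_funs"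
    and "\<And>n. n \<ge> 1 \<Longrightarrow> f n = g n"
  shows "f = g"
  using assms by (auto intro: PiE_ext)

lemma arith_funs_mult_comm: "f \<otimes>\<^bsub>arith_funs\<^esub> g = g \<otimes>\<^bsub>arith_funs\<^esub> f"
proof (rule arith_funs_eqI)
  fix n :: nat assume n: "n \<ge> 1"
  have "(\<Sum>(i, j) | i * j = n. f i * g j) = (\<Sum>(i, j) | i * j = n. g i * f j)"
    by (rule sum.reindex_bij_witness[of _ prod.swap prod.swap]) (auto simp: mult.commute)
  then show "(f \<otimes>\<^bsub>arith_funs\<^esub> g) n = (g \<otimes>\<^bsub>arith_funs\<^esub> f) n"
    using n by (simp add: mult_arith_funs_apply)
qed (rule arith_funs_closed)+

text \<open>Both bracketings of a triple convolution are the same sum, over the factorisations of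
  the argument into three factors.\<close>

lemma mult_mult_arith_funs_apply:
  assumes n: "n \<ge> 1"
  shows "((f \<otimes>\<^bsub>arith_funs\<^esub> g) \<otimes>\<^bsub>arith_funs\<^esub> h) n =
    (\<Sum>(i, j, k) | i * j * k = n. f i * g j * h k)"
proof -
  have "((f \<otimes>\<^bsub>arith_funs\<^esub> g) \<otimes>\<^bsub>arith_funs\<^esub> h) n =
      (\<Sum>x | fst x * snd x = n. (f \<otimes>\<^bsub>arith_funs\<^esub> g) (fst x) * h (snd x))"
    using n by (simp add: mult_arith_funs_apply case_prod_beta')
  also have "\<dots> = (\<Sum>x | fst x * snd x = n. \<Sum>y | fst y * snd y = fst x.
      f (fst y) * g (snd y) * h (snd x))"
  proof (rule sum.cong)
    fix x :: "nat \<times> nat" assume "x \<in> {x. fst x * snd x = n}"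
    then have "fst x \<ge> 1" using n by (cases "fst x") auto
    then show "(f \<otimes>\<^bsub>arith_funs\<^esub> g) (fst x) * h (snd x) =
        (\<Sum>y | fst y * snd y = fst x. f (fst y) * g (snd y) * h (snd x))"
      by (simp add: mult_arith_funs_apply case_prod_beta' sum_distrib_right)
  qed simp
  also have "\<dots> = (\<Sum>(x, y) \<in> (SIGMA x:{x. fst x * snd x = n}. {y. fst y * snd y = fst x}).
      f (fst y) * g (snd y) * h (snd x))"
  proof (rule sum.Sigma)
    show "finite {x. fst x * snd x = n}"
      using finite_factorizations[OF n] by (simp add: case_prod_beta')
    show "\<forall>x\<in>{x. fst x * snd x = n}. finite {y. fst y * snd y = fst x}"
    proof
      fix x :: "nat \<times> nat" assume "x \<in> {x. fst x * snd x = n}"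
      then have "fst x \<ge> 1" using n by (cases "fst x") auto
      then show "finite {y. fst y * snd y = fst x}"
        using finite_factorizations[of "fst x"] by (simp add: case_prod_beta')
    qed
  qed
  also have "\<dots> = (\<Sum>(i, j, k) | i * j * k = n. f i * g j * h k)"
    by (rule sum.reindex_bij_witness
        [of _ "\<lambda>(i, j, k). ((i * j, k), (i, j))" "\<lambda>(x, y). (fst y, snd y, snd x)"]) auto
  finally show ?thesis .
qed

lemma arith_funs_mult_assoc:
  "(f \<otimes>\<^bsub>arith_funs\<^esub> g) \<otimes>\<^bsub>arith_funs\<^esub> h = f \<otimes>\<^bsub>arith_funs\<^esub> (g \<otimes>\<^bsub>arith_funs\<^esub> h)"
proof (rule arith_funs_eqI)
  fix n :: nat assume n: "n \<ge> 1"
  have "(\<Sum>(i, j, k) | i * j * k = n. f i * g j * h k) =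
      (\<Sum>(j, k, i) | j * k * i = n. g j * h k * f i)"
    by (rule sum.reindex_bij_witness[of _ "\<lambda>(j, k, i). (i, j, k)" "\<lambda>(i, j, k). (j, k, i)"])
      (auto simp: ac_simps)
  then show "((f \<otimes>\<^bsub>arith_funs\<^esub> g) \<otimes>\<^bsub>arith_funs\<^esub> h) n = (f \<otimes>\<^bsub>arith_funs\<^esub> (g \<otimes>\<^bsub>arith_funs\<^esub> h)) n"
    using n by (simp add: mult_mult_arith_funs_apply arith_funs_mult_comm[of f "g \<otimes>\<^bsub>arith_funs\<^esub> h"])
qed (rule arith_funs_closed)+

lemma arith_funs_one_mult:
  assumes "f \<in> carrier arith_funs"
  shows "\<one>\<^bsub>arith_funs\<^esub> \<otimes>\<^bsub>arith_funs\<^esub> f = f"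
proof (rule arith_funs_eqI)
  fix n :: nat assume n: "n \<ge> 1"
  have "(\<Sum>(i, j) | i * j = n. \<one>\<^bsub>arith_funs\<^esub> i * f j) = (\<Sum>(i, j) \<in> {(1, n)}. \<one>\<^bsub>arith_funs\<^esub> i * f j)"
  proof (rule sum.mono_neutral_right[OF finite_factorizations[OF n]], safe)
    fix i j assume "n = i * j" and ne: "\<one>\<^bsub>arith_funs\<^esub> i * f j \<noteq> 0"
    with n have "i \<ge> 1" by (cases i) auto
    with ne show "i = 1"
      by (auto simp: one_arith_funs_apply split: if_splits)
    with \<open>n = i * j\<close> show "j = i * j" by simp
  qed simp
  then show "(\<one>\<^bsub>arith_funs\<^esub> \<otimes>\<^bsub>arith_funs\<^esub> f) n = f n"
    using n by (simp add: mult_arith_funs_apply one_arith_funs_apply)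
qed (use assms arith_funs_closed in auto)

lemma arith_funs_add_mult:
  "(f \<oplus>\<^bsub>arith_funs\<^esub> g) \<otimes>\<^bsub>arith_funs\<^esub> h =
    (f \<otimes>\<^bsub>arith_funs\<^esub> h) \<oplus>\<^bsub>arith_funs\<^esub> (g \<otimes>\<^bsub>arith_funs\<^esub> h)"
proof (rule arith_funs_eqI)
  fix n :: nat assume n: "n \<ge> 1"
  have "(\<Sum>(i, j) | i * j = n. (f \<oplus>\<^bsub>arith_funs\<^esub> g) i * h j) =
      (\<Sum>(i, j) | i * j = n. f i * h j + g i * h j)"
  proof (rule sum.cong, goal_cases)
    case (2 x)
    then have "fst x \<ge> 1" using n by (cases "fst x") auto
    then show ?case
      by (cases x) (simp add: add_arith_funs_apply distrib_right)
  qed simp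
  also have "\<dots> = (\<Sum>(i, j) | i * j = n. f i * h j) + (\<Sum>(i, j) | i * j = n. g i * h j)"
    by (simp add: case_prod_beta' sum.distrib)
  finally show "((f \<oplus>\<^bsub>arith_funs\<^esub> g) \<otimes>\<^bsub>arith_funs\<^esub> h) n =
      ((f \<otimes>\<^bsub>arith_funs\<^esub> h) \<oplus>\<^bsub>arith_funs\<^esub> (g \<otimes>\<^bsub>arith_funs\<^esub> h)) n"
    using n by (simp add: mult_arith_funs_apply add_arith_funs_apply)
qed (rule arith_funs_closed)+

lemma abelian_group_arith_funs: "abelian_group arith_funs"
proof (rule abelian_groupI)
  fix f assume f: "f \<in> carrier arith_funs"
  let ?g = "\<lambda>n\<in>{1..}. - f n"
  have "?g \<oplus>\<^bsub>arith_funs\<^esub> f = \<zero>\<^bsub>arith_funs\<^esub>"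
    by (rule arith_funs_eqI)
      (simp_all add: arith_funs_closed[simplified] add_arith_funs_apply zero_arith_funs_apply)
  moreover have "?g \<in> carrier arith_funs" by simp
  ultimately show "\<exists>g\<in>carrier arith_funs. g \<oplus>\<^bsub>arith_funs\<^esub> f = \<zero>\<^bsub>arith_funs\<^esub>" by blast
  show "\<zero>\<^bsub>arith_funs\<^esub> \<oplus>\<^bsub>arith_funs\<^esub> f = f"
    by (rule arith_funs_eqI[OF arith_funs_closed(1) f])
      (simp add: add_arith_funs_apply zero_arith_funs_apply)
next
  fix f g h
  show "(f \<oplus>\<^bsub>arith_funs\<^esub> g) \<oplus>\<^bsub>arith_funs\<^esub> h = f \<oplus>\<^bsub>arith_funs\<^esub> (g \<oplus>\<^bsub>arith_funs\<^esub> h)"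
    by (rule arith_funs_eqI[OF arith_funs_closed(1) arith_funs_closed(1)])
      (simp add: add_arith_funs_apply)
  show "f \<oplus>\<^bsub>arith_funs\<^esub> g = g \<oplus>\<^bsub>arith_funs\<^esub> f"
    by (rule arith_funs_eqI[OF arith_funs_closed(1) arith_funs_closed(1)])
      (simp add: add_arith_funs_apply)
qed (rule arith_funs_closed)+

lemma cring_arith_funs: "cring arith_funs"
  by (intro cringI abelian_group_arith_funs comm_monoidI arith_funs_closed
      arith_funs_mult_assoc arith_funs_mult_comm arith_funs_one_mult arith_funs_add_mult)

section \<open>Vanishing ideals\<close>

definition vanishing_ideal :: "nat set \<Rightarrow> (nat \<Rightarrow> complex) set" where
  "vanishing_ideal D = {f \<in> carrier arith_funs. \<forall>n\<in>D. f n = 0}"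

text \<open>Vanishing on \<open>D\<close> survives multiplication because in each factorisation of an element
  of \<open>D\<close> both factors lie in \<open>D\<close>.\<close>

lemma ideal_vanishing_ideal:
  assumes pos: "D \<subseteq> {1..}" and D: "\<And>a b. a * b \<in> D \<Longrightarrow> a \<in> D \<and> b \<in> D"
  shows "ideal (vanishing_ideal D) arith_funs"
proof -
  interpret cring arith_funs by (rule cring_arith_funs)
  have mult: "f \<otimes>\<^bsub>arith_funs\<^esub> g \<in> vanishing_ideal D" if f: "f \<in> vanishing_ideal D" for f g
  proof -
    have "(f \<otimes>\<^bsub>arith_funs\<^esub> g) n = 0" if n: "n \<in> D" for n
    proof -
      have "(\<Sum>(i, j) | i * j = n. f i * g j) = 0"
      proof (rule sum.neutral, rule ballI)
        fix x assume "x \<in> {(i, j). i * j = n}"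
        then have "fst x * snd x \<in> D" using n by auto
        then have "fst x \<in> D" using D by blast
        then have "f (fst x) = 0" using f by (simp add: vanishing_ideal_def)
        then show "(case x of (i, j) \<Rightarrow> f i * g j) = 0" by (simp add: case_prod_beta')
      qed
      moreover have "n \<ge> 1" using n pos by auto
      ultimately show ?thesis by (simp add: mult_arith_funs_apply)
    qed
    then show ?thesis using arith_funs_closed(2) by (auto simp: vanishing_ideal_def)
  qed
  show ?thesis
  proof (rule idealI)
    show "ring arith_funs" by (rule ring_axioms)
    show "subgroup (vanishing_ideal D) (add_monoid arith_funs)"
    proof (rule subgroup.intro)
      show "vanishing_ideal D \<subseteq> carrier (add_monoid arith_funs)"
        by (auto simp: vanishing_ideal_def)
      show "\<one>\<^bsub>add_monoid arith_funs\<^esub> \<in> vanishing_ideal D"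
        using pos zero_closed by (auto simp: vanishing_ideal_def zero_arith_funs_apply)
    next
      fix f g assume "f \<in> vanishing_ideal D" "g \<in> vanishing_ideal D"
      then show "f \<otimes>\<^bsub>add_monoid arith_funs\<^esub> g \<in> vanishing_ideal D"
        using pos arith_funs_closed(1)[of f g]
        by (auto simp: vanishing_ideal_def add_arith_funs_apply subset_iff)
    next
      fix f assume f: "f \<in> vanishing_ideal D"
      then have fc: "f \<in> carrier arith_funs" by (simp add: vanishing_ideal_def)
      \<comment> \<open>Negation is multiplication by \<open>- 1\<close>, so closure under products covers it.\<close>
      have "\<ominus>\<^bsub>arith_funs\<^esub> f = f \<otimes>\<^bsub>arith_funs\<^esub> (\<ominus>\<^bsub>arith_funs\<^esub> \<one>\<^bsub>arith_funs\<^esub>)"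
        using r_minus[OF fc one_closed] fc by simp
      then have "\<ominus>\<^bsub>arith_funs\<^esub> f \<in> vanishing_ideal D"
        using mult[OF f] by simp
      then show "inv\<^bsub>add_monoid arith_funs\<^esub> f \<in> vanishing_ideal D"
        by (simp add: a_inv_def)
    qed
  next
    fix f g assume f: "f \<in> vanishing_ideal D"
    show "f \<otimes>\<^bsub>arith_funs\<^esub> g \<in> vanishing_ideal D" by (rule mult[OF f])
    then show "g \<otimes>\<^bsub>arith_funs\<^esub> f \<in> vanishing_ideal D" by (simp add: arith_funs_mult_comm)
  qed
qed

text \<open>A term \<open>f i * g j\<close> of the convolution can only be nonzero if \<open>i \<ge> a\<close> and \<open>j \<ge> b\<close>. If one
  of these were strict, \<open>i * j\<close> would exceed \<open>a * b\<close>, so the term at \<open>(a, b)\<close> is the only one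
  that can contribute.\<close>

lemma mult_arith_funs_apply_least:
  assumes D: "\<And>a b. a * b \<in> D \<Longrightarrow> a \<in> D \<and> b \<in> D"
    and ab: "a * b \<in> D" "a * b \<ge> 1"
    and f: "\<And>i. i \<in> D \<Longrightarrow> i < a \<Longrightarrow> f i = 0"
    and g: "\<And>j. j \<in> D \<Longrightarrow> j < b \<Longrightarrow> g j = 0"
  shows "(f \<otimes>\<^bsub>arith_funs\<^esub> g) (a * b) = f a * g b"
proof -
  have "(\<Sum>(i, j) | i * j = a * b. f i * g j) = (\<Sum>(i, j) \<in> {(a, b)}. f i * g j)"
  proof (rule sum.mono_neutral_right[OF finite_factorizations[OF ab(2)]])
    show "\<forall>x\<in>{(i, j). i * j = a * b} - {(a, b)}. (case x of (i, j) \<Rightarrow> f i * g j) = 0"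
    proof (rule ballI, rule ccontr)
      fix x assume "x \<in> {(i, j). i * j = a * b} - {(a, b)}"
        and "(case x of (i, j) \<Rightarrow> f i * g j) \<noteq> 0"
      then obtain i j where ij: "i * j = a * b" and notab: "(i, j) \<noteq> (a, b)"
        and ne: "f i * g j \<noteq> 0" by (cases x) (simp, blast)
      have "i \<in> D" "j \<in> D" using D[of i j] ij ab(1) by auto
      with ne f g have le: "a \<le> i" "b \<le> j" by (auto simp: not_less[symmetric])
      have "a > 0" "b > 0" using ab(2) by (simp_all add: Suc_le_eq)
      have "i = a"
      proof (rule ccontr)
        assume "i \<noteq> a"
        with le have "a * b < i * b" using \<open>b > 0\<close> by simp
        also have "\<dots> \<le> i * j" using le by simp
        finally show False using ij by simp
      qed
      with ij \<open>a > 0\<close> have "j = b" by simp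
      with \<open>i = a\<close> notab show False by simp
    qed
  qed simp
  then show ?thesis using ab(2) by (simp add: mult_arith_funs_apply)
qed

lemma primeideal_vanishing_ideal:
  assumes pos: "D \<subseteq> {1..}" and one: "1 \<in> D"
    and D: "\<And>a b. a * b \<in> D \<longleftrightarrow> a \<in> D \<and> b \<in> D"
  shows "primeideal (vanishing_ideal D) arith_funs"
proof (rule primeidealI)
  show "ideal (vanishing_ideal D) arith_funs"
    using pos D by (intro ideal_vanishing_ideal) auto
  show "cring arith_funs" by (rule cring_arith_funs)
  have "\<one>\<^bsub>arith_funs\<^esub> \<notin> vanishing_ideal D"
    using one by (auto simp: vanishing_ideal_def one_arith_funs_apply intro!: bexI[of _ 1])
  then show "carrier arith_funs \<noteq> vanishing_ideal D"
    using arith_funs_closed(4) by blast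
next
  fix f g
  assume fg: "f \<in> carrier arith_funs" "g \<in> carrier arith_funs"
    and prod: "f \<otimes>\<^bsub>arith_funs\<^esub> g \<in> vanishing_ideal D"
  show "f \<in> vanishing_ideal D \<or> g \<in> vanishing_ideal D"
  proof (rule ccontr)
    assume "\<not> ?thesis"
    then have ex: "\<exists>n. n \<in> D \<and> f n \<noteq> 0" "\<exists>n. n \<in> D \<and> g n \<noteq> 0"
      using fg by (auto simp: vanishing_ideal_def)
    define a b where "a = (LEAST n. n \<in> D \<and> f n \<noteq> 0)" and "b = (LEAST n. n \<in> D \<and> g n \<noteq> 0)"
    have a: "a \<in> D" "f a \<noteq> 0" and b: "b \<in> D" "g b \<noteq> 0"
      using LeastI_ex[OF ex(1)] LeastI_ex[OF ex(2)] by (auto simp: a_def b_def)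
    have "(f \<otimes>\<^bsub>arith_funs\<^esub> g) (a * b) = f a * g b"
    proof (rule mult_arith_funs_apply_least)
      show "f i = 0" if "i \<in> D" "i < a" for i
        using not_less_Least that by (auto simp: a_def)
      show "g j = 0" if "j \<in> D" "j < b" for j
        using not_less_Least that by (auto simp: b_def)
      show "a * b \<in> D" using a b D by auto
      then show "a * b \<ge> 1" using pos by auto
    qed (use D in auto)
    moreover have "(f \<otimes>\<^bsub>arith_funs\<^esub> g) (a * b) = 0"
      using prod a b D by (simp add: vanishing_ideal_def)
    ultimately show False using a b by simp
  qed
qed

section \<open>The chain of prime ideals\<close>

text \<open>In the power series picture these are the monomials free of the first \<open>k\<close> variables, so
  the vanishing ideal of this set is the kernel of setting those variables to zero.\<close>

definition sieve :: "nat \<Rightarrow> nat set" where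
  "sieve k = {n. n \<ge> 1 \<and> (\<forall>i<k. \<not> enumerate {p. prime p} i dvd n)}"

lemma prime_enumerate: "prime (enumerate {p::nat. prime p} i)"
  using enumerate_in_set[OF primes_infinite] by blast

lemma primeideal_vanishing_ideal_sieve: "primeideal (vanishing_ideal (sieve k)) arith_funs"
proof (rule primeideal_vanishing_ideal)
  have "\<not> enumerate {p::nat. prime p} i dvd 1" for i
    using prime_enumerate[of i] not_prime_unit by blast
  then show "1 \<in> sieve k"
    by (simp add: sieve_def)
  show "a * b \<in> sieve k \<longleftrightarrow> a \<in> sieve k \<and> b \<in> sieve k" for a b
  proof -
    have "a * b \<ge> 1 \<longleftrightarrow> a \<ge> 1 \<and> b \<ge> 1"
      by (simp add: Suc_le_eq)
    moreover have "enumerate {p. prime p} i dvd a * b \<longleftrightarrow>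
        enumerate {p. prime p} i dvd a \<or> enumerate {p. prime p} i dvd b" for i
      by (rule prime_dvd_mult_iff[OF prime_enumerate])
    ultimately show ?thesis
      by (simp only: sieve_def mem_Collect_eq) blast
  qed
  show "sieve k \<subseteq> {1..}"
    by (auto simp: sieve_def)
qed

lemma vanishing_ideal_sieve_psubset:
  "vanishing_ideal (sieve k) \<subset> vanishing_ideal (sieve (Suc k))"
proof
  show "vanishing_ideal (sieve k) \<subseteq> vanishing_ideal (sieve (Suc k))"
    by (auto simp: vanishing_ideal_def sieve_def)
  define p where "p = enumerate {p::nat. prime p} k"
  have p: "prime p" unfolding p_def by (rule prime_enumerate)
  then have p_ge: "p \<ge> 1" by (simp add: Suc_le_eq prime_gt_0_nat)
  \<comment> \<open>The enumeration starts at index \<open>0\<close>, so \<open>p\<close> is the prime that \<open>sieve (Suc k)\<close> newly excludes.\<close>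
  have "p \<in> sieve k"
  proof -
    have "\<not> enumerate {p. prime p} i dvd p" if "i < k" for i
      using primes_dvd_imp_eq[OF prime_enumerate p, of i]
        enumerate_mono[OF that primes_infinite] by (simp add: p_def) blast
    with p_ge show ?thesis by (auto simp: sieve_def)
  qed
  moreover have "p \<notin> sieve (Suc k)" by (auto simp: sieve_def p_def)
  moreover define f :: "nat \<Rightarrow> complex" where "f = (\<lambda>n\<in>{1..}. if n = p then 1 else 0)"
  ultimately have "f \<notin> vanishing_ideal (sieve k)" "f \<in> vanishing_ideal (sieve (Suc k))"
    using p_ge by (auto simp: vanishing_ideal_def sieve_def)
  then show "vanishing_ideal (sieve k) \<noteq> vanishing_ideal (sieve (Suc k))" by blast
qed

theorem proposition3p22: "krull_dim arith_funs = \<infinity>"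
proof -
  have "ereal (real n) \<le> krull_dim arith_funs" for n
    unfolding krull_dim_def
  proof (rule Sup_upper, intro CollectI exI conjI)
    show "\<forall>i\<le>n. primeideal (vanishing_ideal (sieve i)) arith_funs"
      by (simp add: primeideal_vanishing_ideal_sieve)
    show "\<forall>i<n. vanishing_ideal (sieve i) \<subset> vanishing_ideal (sieve (Suc i))"
      by (simp add: vanishing_ideal_sieve_psubset)
  qed (rule refl)
  moreover have "\<exists>n. ereal B \<le> ereal (real n)" for B
    using real_arch_simple[of B] by simp
  ultimately show ?thesis
    by (meson ereal_top order_trans)
qed

end
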